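(* Let $\Omega\subsetneq\mathbb{R}^n$ be a domain, $x,y\in\Omega$ and $a,b\ge1$. If there exists a rectifiable curve $\gamma_{x,y}$ in $\Omega$ connecting $x$ and $y$ and satisfying $$|\gamma_{x,y}|\le a|x-y|\qquad\text{and}\qquad\min\{|x-z|,|y-z|\}\le b\,d_\Omega(z)\quad\text{for all }z\in\gamma_{x,y},$$ then $$k_\Omega(x,y)\le C_{a,b,n}\left[1+j_\Omega(x,y)\right]$$ with $C_{a,b,n}\le C_n a^n b^n$, where $C_n$ is a constant depending on $n$ only.
   Context: A domain is a nonempty open connected set. $d_\Omega(x)=\mathrm{dist}(x,\partial\Omega)$; $|\gamma|$ denotes the arclength of a curve $\gamma$. The quasihyperbolic metric is $k_\Omega(x,y)=\inf_\gamma\int_\gamma\frac{ds}{d_\Omega(z)}$, the infimum over all rectifiable curves $\gamma\subset\Omega$ connecting $x$ and $y$. The distance-ratio metric is $$j_\Omega(x,y)=\frac12\log\left[\left(1+\frac{|x-y|}{d_\Omega(x)}\right)\left(1+\frac{|x-y|}{d_\Omega(y)}\right)\right].$$ *)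

theory Defs
  imports "HOL-Analysis.Analysis"
begin

text \<open>
  Curves are the library's paths, i.e. continuous maps on the interval from 0 to 1.
  The polygonal sums below need not use the endpoints of the interval; this does not change
  their supremum, and it makes the set of sums nonempty (take \<open>N = 0\<close>).
\<close>

definition polygonal_sums :: "(real \<Rightarrow> 'a::metric_space) \<Rightarrow> real \<Rightarrow> real \<Rightarrow> real set" where
  "polygonal_sums g u v =
     {\<Sum>i<N. dist (g (t i)) (g (t (Suc i))) | N t. mono_on {..N} t \<and> t ` {..N} \<subseteq> {u..v}}"

definition arclength_between :: "(real \<Rightarrow> 'a::metric_space) \<Rightarrow> real \<Rightarrow> real \<Rightarrow> real" where
  "arclength_between g u v = Sup (polygonal_sums g u v)"

definition rectifiable_path :: "(real \<Rightarrow> 'a::metric_space) \<Rightarrow> bool" where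
  "rectifiable_path g \<longleftrightarrow> path g \<and> bdd_above (polygonal_sums g 0 1)"

text \<open>Arclength is meaningful for rectifiable paths only: otherwise it is the supremum of an
  unbounded set of reals.\<close>

definition arclength :: "(real \<Rightarrow> 'a::metric_space) \<Rightarrow> real" where
  "arclength g = arclength_between g 0 1"

text \<open>The point of \<open>g\<close> at distance \<open>s\<close> along the curve, for \<open>s\<close> between 0 and the arclength
  of \<open>g\<close>. It does not depend on the parameter chosen, as \<open>g\<close> is constant between any two
  parameters with the same value of \<open>arclength_between g 0\<close>.\<close>

definition arclength_parametrization :: "(real \<Rightarrow> 'a::metric_space) \<Rightarrow> real \<Rightarrow> 'a" where
  "arclength_parametrization g s = g (SOME t. t \<in> {0..1} \<and> arclength_between g 0 t = s)"

definition arclength_integral :: "(real \<Rightarrow> 'a::metric_space) \<Rightarrow> ('a \<Rightarrow> real) \<Rightarrow> real" where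
  "arclength_integral g f = integral {0..arclength g} (\<lambda>s. f (arclength_parametrization g s))"

definition boundary_dist :: "'a::metric_space set \<Rightarrow> 'a \<Rightarrow> real" where
  "boundary_dist \<Omega> x = infdist x (frontier \<Omega>)"

definition joins_in :: "(real \<Rightarrow> 'a::metric_space) \<Rightarrow> 'a set \<Rightarrow> 'a \<Rightarrow> 'a \<Rightarrow> bool" where
  "joins_in g \<Omega> x y \<longleftrightarrow>
     rectifiable_path g \<and> path_image g \<subseteq> \<Omega> \<and> pathstart g = x \<and> pathfinish g = y"

definition quasihyperbolic_dist :: "'a::metric_space set \<Rightarrow> 'a \<Rightarrow> 'a \<Rightarrow> real" where
  "quasihyperbolic_dist \<Omega> x y =
     Inf {arclength_integral g (\<lambda>z. 1 / boundary_dist \<Omega> z) | g. joins_in g \<Omega> x y}"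

definition distance_ratio :: "'a::metric_space set \<Rightarrow> 'a \<Rightarrow> 'a \<Rightarrow> real" where
  "distance_ratio \<Omega> x y =
     1 / 2 * ln ((1 + dist x y / boundary_dist \<Omega> x) * (1 + dist x y / boundary_dist \<Omega> y))"

end

theory Submission
  imports Defs
begin

text \<open>
  Write \<open>d\<close> for the boundary distance. Join \<open>x\<close> to \<open>y\<close> by a chain of points \<open>p i\<close> of the
  given curve with \<open>dist (p i) (p (i + 1)) \<le> d (p i) / 2\<close>, of minimal length \<open>N\<close>. Each edge of the
  polygon through these points has quasihyperbolic length at most 1, so the quasihyperbolic distance
  is at most \<open>N\<close>. By minimality no shortcut is possible: non-consecutive points are more than
  \<open>d (p i) / 2\<close> apart. At a fixed dyadic distance from \<open>x\<close> (or \<open>y\<close>, whichever is closer) the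
  hypothesis bounds \<open>d\<close> from below, so comparing volumes of disjoint balls leaves \<open>O(b^n)\<close> points per
  scale; the curve stays within \<open>a |x - y|\<close> of both endpoints, so the number of scales is
  \<open>O(1 + log a + j(x, y))\<close>.
\<close>

section \<open>Polygons: parametrization and arclength\<close>

definition unit_clamp :: "real \<Rightarrow> real" where
  "unit_clamp u = max 0 (min 1 u)"

text \<open>Every edge contributes its clamped increment at every parameter, so continuity is
  immediate and differences of values are linear in differences of clamps. For \<open>N = 0\<close>
  the polygon is the constant \<open>p 0\<close>.\<close>

definition polygon :: "(nat \<Rightarrow> 'a::real_normed_vector) \<Rightarrow> nat \<Rightarrow> real \<Rightarrow> 'a" where
  "polygon p N t = p 0 + (\<Sum>i<N. unit_clamp (real N * t - real i) *\<^sub>R (p (Suc i) - p i))"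

text \<open>The intended value of the arclength from 0 to \<open>t\<close>;
  \<open>arclength_between_polygon\<close> confirms it.\<close>

definition polygon_length :: "(nat \<Rightarrow> 'a::real_normed_vector) \<Rightarrow> nat \<Rightarrow> real \<Rightarrow> real" where
  "polygon_length p N t = (\<Sum>i<N. unit_clamp (real N * t - real i) * dist (p i) (p (Suc i)))"

lemma unit_clamp_mono: "u \<le> v \<Longrightarrow> unit_clamp u \<le> unit_clamp v"
  by (auto simp: unit_clamp_def)

lemma unit_clamp_bounds: "0 \<le> unit_clamp u" "unit_clamp u \<le> 1"
  by (auto simp: unit_clamp_def)

lemma continuous_on_polygon: "continuous_on A (polygon p N)"
  unfolding polygon_def unit_clamp_def by (intro continuous_intros)

lemma continuous_on_polygon_length: "continuous_on A (polygon_length p N)"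
  unfolding polygon_length_def unit_clamp_def by (intro continuous_intros)

text \<open>The vertex \<open>p i\<close> is reached at the parameter \<open>i / N\<close>.\<close>

lemma polygon_on_edge:
  assumes "i < N" "real i \<le> real N * t" "real N * t \<le> real i + 1"
  shows "polygon p N t = p i + (real N * t - real i) *\<^sub>R (p (Suc i) - p i)"
proof -
  define v where "v j = p (Suc j) - p j" for j
  have "unit_clamp (real N * t - real j) *\<^sub>R v j =
      (if j < i then v j else 0) + (if j = i then (real N * t - real i) *\<^sub>R v i else 0)" for j
  proof (cases j i rule: linorder_cases)
    case less
    then have "real j + 1 \<le> real i" by linarith
    with less assms show ?thesis by (simp add: unit_clamp_def)
  next
    case equal
    with assms show ?thesis by (simp add: unit_clamp_def)
  next
    case greater
    then have "real i + 1 \<le> real j" by linarith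
    with greater assms show ?thesis by (simp add: unit_clamp_def)
  qed
  then have "(\<Sum>j<N. unit_clamp (real N * t - real j) *\<^sub>R v j) =
      (\<Sum>j<N. if j < i then v j else 0) + (real N * t - real i) *\<^sub>R v i"
    using assms(1) by (simp add: sum.distrib)
  also have "(\<Sum>j<N. if j < i then v j else 0) = (\<Sum>j<i. v j)"
    using assms(1) by (intro sum.mono_neutral_cong_right) auto
  also have "\<dots> = p i - p 0"
    unfolding v_def by (rule sum_lessThan_telescope)
  finally show ?thesis by (simp add: polygon_def v_def)
qed

lemma polygon_on_edge_in_segment:
  assumes "i < N" "real i \<le> real N * t" "real N * t \<le> real i + 1"
  shows "polygon p N t \<in> closed_segment (p i) (p (Suc i))"
  using polygon_on_edge[OF assms, of p] assms unfolding closed_segment_def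
  by (intro CollectI exI[of _ "real N * t - real i"]) (simp add: algebra_simps)

lemma edge_exists:
  assumes "t \<in> {0..1}" "0 < N"
  obtains i where "i < N" "real i \<le> real N * t" "real N * t \<le> real i + 1"
\<comment> \<open>At \<open>t = 1\<close> the floor of \<open>N * t\<close> is \<open>N\<close>,
  which indexes no edge; the last edge is taken instead.\<close>
proof (cases "t = 1")
  case True
  with assms show ?thesis by (intro that[of "N - 1"]) (auto simp: of_nat_diff)
next
  case False
  define i where "i = nat \<lfloor>real N * t\<rfloor>"
  have "0 \<le> real N * t" using assms by simp
  then have i: "real i \<le> real N * t" "real N * t \<le> real i + 1"
    unfolding i_def by linarith+
  have "t < 1" using assms(1) False by simp
  then have "real N * t < real N" using assms(2) by simp
  with i have "i < N" by linarith
  with i show ?thesis by (rule that[rotated 1])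
qed

lemma polygon_0: "polygon p N 0 = p 0"
proof -
  have "unit_clamp (- real i) = 0" for i by (simp add: unit_clamp_def)
  then show ?thesis by (simp add: polygon_def)
qed

lemma unit_clamp_end: "i < N \<Longrightarrow> unit_clamp (real N - real i) = 1"
  by (simp add: unit_clamp_def)

lemma polygon_1: "polygon p N 1 = p N"
proof -
  have "(\<Sum>i<N. unit_clamp (real N - real i) *\<^sub>R (p (Suc i) - p i)) = (\<Sum>i<N. p (Suc i) - p i)"
    by (intro sum.cong) (simp_all add: unit_clamp_end)
  then show ?thesis by (simp add: polygon_def sum_lessThan_telescope)
qed

lemma polygon_length_0: "polygon_length p N 0 = 0"
proof -
  have "unit_clamp (- real i) = 0" for i by (simp add: unit_clamp_def)
  then show ?thesis by (simp add: polygon_length_def)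
qed

lemma polygon_length_1: "polygon_length p N 1 = (\<Sum>i<N. dist (p i) (p (Suc i)))"
  unfolding polygon_length_def by (intro sum.cong) (simp_all add: unit_clamp_end)

text \<open>Clamps are monotone in the parameter, so all coefficients of the increment are
  nonnegative and the triangle inequality yields exactly the increment of
  \<open>polygon_length\<close>.\<close>

lemma dist_polygon_le:
  assumes "s \<le> t"
  shows "dist (polygon p N s) (polygon p N t) \<le> polygon_length p N t - polygon_length p N s"
proof -
  define c where "c t i = unit_clamp (real N * t - real i)" for t i
  have c: "c s i \<le> c t i" for i
    unfolding c_def using assms by (intro unit_clamp_mono diff_right_mono mult_left_mono) auto
  have "polygon p N t - polygon p N s = (\<Sum>i<N. (c t i - c s i) *\<^sub>R (p (Suc i) - p i))"
    by (simp add: polygon_def c_def sum_subtractf scaleR_diff_left)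
  then have "dist (polygon p N s) (polygon p N t) = norm (\<Sum>i<N. (c t i - c s i) *\<^sub>R (p (Suc i) - p i))"
    by (metis dist_commute dist_norm)
  also have "\<dots> \<le> (\<Sum>i<N. (c t i - c s i) * dist (p i) (p (Suc i)))"
    using c by (intro sum_norm_le) (simp add: dist_norm norm_minus_commute)
  also have "\<dots> = polygon_length p N t - polygon_length p N s"
    by (simp add: polygon_length_def c_def sum_subtractf left_diff_distrib)
  finally show ?thesis .
qed

text \<open>Upper half of the arclength computation: each chord is bounded by an increment of
  \<open>polygon_length\<close>, and these telescope.\<close>

lemma polygonal_sums_polygon_le:
  assumes "S \<in> polygonal_sums (polygon p N) 0 t"
  shows "S \<le> polygon_length p N t"
proof -
  from assms obtain M \<tau> where S: "S = (\<Sum>i<M. dist (polygon p N (\<tau> i)) (polygon p N (\<tau> (Suc i))))"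
    and mono: "mono_on {..M} \<tau>" and range: "\<tau> ` {..M} \<subseteq> {0..t}"
    unfolding polygonal_sums_def by blast
  have *: "polygon_length p N u \<le> polygon_length p N v" if "u \<le> v" for u v
    using dist_polygon_le[OF that, of p N] zero_le_dist[of "polygon p N u" "polygon p N v"] by linarith
  have "S \<le> (\<Sum>i<M. polygon_length p N (\<tau> (Suc i)) - polygon_length p N (\<tau> i))"
    unfolding S using mono by (intro sum_mono dist_polygon_le) (auto simp: mono_on_def)
  also have "\<dots> = polygon_length p N (\<tau> M) - polygon_length p N (\<tau> 0)"
    by (rule sum_lessThan_telescope)
  also have "\<dots> \<le> polygon_length p N t - polygon_length p N 0"
    using range by (intro diff_mono *) auto
  finally show ?thesis by (simp add: polygon_length_0)
qed

text \<open>Lower half: the supremum is attained, by the partition at the vertices.\<close>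

lemma polygon_length_in_polygonal_sums:
  assumes "0 \<le> t"
  shows "polygon_length p N t \<in> polygonal_sums (polygon p N) 0 t"
proof -
  \<comment> \<open>The vertex parameters, cut off at \<open>t\<close>. Between
    \<open>\<tau> i\<close> and \<open>\<tau> (Suc i)\<close> only edge \<open>i\<close> moves, by
    the fraction of it traversed up to \<open>t\<close>; terms beyond \<open>t\<close>
    vanish.\<close>
  define \<tau> where "\<tau> i = min (real i / real N) t" for i
  have "dist (polygon p N (\<tau> i)) (polygon p N (\<tau> (Suc i))) =
      unit_clamp (real N * t - real i) * dist (p i) (p (Suc i))" if "i < N" for i
  proof -
    have N: "real N * \<tau> k = min (real k) (real N * t)" for k
      using that by (simp add: \<tau>_def min_def field_simps)
    have "unit_clamp (real N * \<tau> (Suc i) - real j) - unit_clamp (real N * \<tau> i - real j) =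
        (if j = i then unit_clamp (real N * t - real i) else 0)" for j
    proof (cases j i rule: linorder_cases)
      case less
      then have "real j + 1 \<le> real i" by linarith
      with less show ?thesis unfolding N unit_clamp_def by auto
    next
      case equal
      then show ?thesis unfolding N unit_clamp_def by auto
    next
      case greater
      then have "real i + 1 \<le> real j" by linarith
      with greater show ?thesis unfolding N unit_clamp_def by auto
    qed
    then have "polygon p N (\<tau> (Suc i)) - polygon p N (\<tau> i) =
        (\<Sum>j<N. (if j = i then unit_clamp (real N * t - real i) else 0) *\<^sub>R (p (Suc j) - p j))"
      by (simp add: polygon_def flip: sum_subtractf scaleR_diff_left)
    also have "\<dots> = (\<Sum>j<N. if j = i then unit_clamp (real N * t - real i) *\<^sub>R (p (Suc i) - p i) else 0)"
      by (intro sum.cong) auto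
    also have "\<dots> = unit_clamp (real N * t - real i) *\<^sub>R (p (Suc i) - p i)"
      using that by simp
    finally have "norm (polygon p N (\<tau> (Suc i)) - polygon p N (\<tau> i)) =
        unit_clamp (real N * t - real i) * norm (p (Suc i) - p i)"
      by (simp add: unit_clamp_bounds)
    then show ?thesis by (simp add: dist_norm norm_minus_commute)
  qed
  then have "polygon_length p N t = (\<Sum>i<N. dist (polygon p N (\<tau> i)) (polygon p N (\<tau> (Suc i))))"
    by (simp add: polygon_length_def)
  moreover have "mono_on {..N} \<tau>"
    unfolding \<tau>_def by (intro mono_onI min.mono divide_right_mono) auto
  moreover have "\<tau> ` {..N} \<subseteq> {0..t}"
    using assms by (auto simp: \<tau>_def)
  ultimately show ?thesis
    unfolding polygonal_sums_def by blast
qed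

lemma arclength_between_polygon:
  assumes "0 \<le> t"
  shows "arclength_between (polygon p N) 0 t = polygon_length p N t"
  unfolding arclength_between_def
  by (intro cSup_eq_maximum polygon_length_in_polygonal_sums polygonal_sums_polygon_le assms)

lemma rectifiable_path_polygon: "rectifiable_path (polygon p N)"
  unfolding rectifiable_path_def path_def
  by (auto intro: continuous_on_polygon bdd_aboveI polygonal_sums_polygon_le)

text \<open>Together with \<open>polygon_length_ge\<close> this is used contrapositively, to locate
  the edge on which a given length is reached.\<close>

lemma polygon_length_le:
  assumes "real N * t \<le> real i" "i \<le> N"
  shows "polygon_length p N t \<le> (\<Sum>j<i. dist (p j) (p (Suc j)))"
proof -
  have "polygon_length p N t \<le> (\<Sum>j<N. if j < i then dist (p j) (p (Suc j)) else 0)"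
    unfolding polygon_length_def
  proof (intro sum_mono)
    fix j
    show "unit_clamp (real N * t - real j) * dist (p j) (p (Suc j)) \<le>
        (if j < i then dist (p j) (p (Suc j)) else 0)"
      using assms unit_clamp_bounds[of "real N * t - real j"]
      by (auto simp: unit_clamp_def intro: mult_left_le_one_le)
  qed
  also have "\<dots> = (\<Sum>j<i. dist (p j) (p (Suc j)))"
    using assms(2) by (intro sum.mono_neutral_cong_right) auto
  finally show ?thesis .
qed

lemma polygon_length_ge:
  assumes "real i \<le> real N * t" "i \<le> N"
  shows "(\<Sum>j<i. dist (p j) (p (Suc j))) \<le> polygon_length p N t"
proof -
  have "(\<Sum>j<i. dist (p j) (p (Suc j))) = (\<Sum>j<i. unit_clamp (real N * t - real j) * dist (p j) (p (Suc j)))"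
  proof (intro sum.cong refl)
    fix j assume "j \<in> {..<i}"
    then have "real j + 1 \<le> real i" by (simp add: Suc_le_eq flip: of_nat_Suc)
    with assms(1) show "dist (p j) (p (Suc j)) = unit_clamp (real N * t - real j) * dist (p j) (p (Suc j))"
      by (simp add: unit_clamp_def)
  qed
  also have "\<dots> \<le> polygon_length p N t"
    unfolding polygon_length_def using assms(2)
    by (intro sum_mono2) (auto simp: unit_clamp_bounds)
  finally show ?thesis .
qed

text \<open>The choice operator may return any parameter of length \<open>s\<close>. Both
  inequalities are strict, so every such parameter belongs to edge \<open>i\<close>.\<close>

lemma arclength_parametrization_polygon:
  assumes "i < N" "(\<Sum>j<i. dist (p j) (p (Suc j))) < s" "s < (\<Sum>j<Suc i. dist (p j) (p (Suc j)))"
  shows "arclength_parametrization (polygon p N) s \<in> closed_segment (p i) (p (Suc i))"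
proof -
  let ?Q = "\<lambda>t. t \<in> {0..1} \<and> arclength_between (polygon p N) 0 t = s"
  have "0 \<le> s"
    using assms(2) sum_nonneg[of "{..<i}" "\<lambda>j. dist (p j) (p (Suc j))"] by simp
  moreover have "(\<Sum>j<Suc i. dist (p j) (p (Suc j))) \<le> (\<Sum>j<N. dist (p j) (p (Suc j)))"
    using assms(1) by (intro sum_mono2) auto
  \<comment> \<open>The intermediate value theorem supplies a parameter, so that the choice is
    meaningful.\<close>
  ultimately have "\<exists>t\<ge>0. t \<le> 1 \<and> polygon_length p N t = s"
    using assms(3)
    by (intro IVT' continuous_on_polygon_length) (auto simp: polygon_length_0 polygon_length_1)
  then have "\<exists>t. ?Q t"
    by (auto simp: arclength_between_polygon)
  then have t: "?Q (SOME t. ?Q t)" by (rule someI_ex)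
  define t where "t = (SOME t. ?Q t)"
  from t have "t \<in> {0..1}" and len: "polygon_length p N t = s"
    unfolding t_def[symmetric] by (auto simp: arclength_between_polygon)
  have "real i \<le> real N * t"
    using polygon_length_le[of N t i p] assms len by (intro leI notI) simp
  moreover have "real N * t \<le> real i + 1"
    using polygon_length_ge[of "Suc i" N t p] assms len by (intro leI notI) simp
  ultimately have "polygon p N t \<in> closed_segment (p i) (p (Suc i))"
    by (rule polygon_on_edge_in_segment[OF assms(1)])
  then show ?thesis by (simp add: arclength_parametrization_def t_def)
qed

section \<open>Integrals along polygons\<close>

text \<open>Shows that the infimum in \<open>quasihyperbolic_dist\<close> is over a set bounded
  below. A non-integrable integrand gives the default value 0.\<close>

lemma arclength_integral_nonneg:
  assumes "\<And>z. 0 \<le> f z"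
  shows "0 \<le> arclength_integral g f"
  unfolding arclength_integral_def
  by (cases "(\<lambda>s. f (arclength_parametrization g s)) integrable_on {0..arclength g}")
    (auto intro: integral_nonneg assms simp: not_integrable_integral)

lemma arclength_integral_polygon_le:
  assumes f: "\<And>i z. i < N \<Longrightarrow> z \<in> closed_segment (p i) (p (Suc i)) \<Longrightarrow> f z \<le> M i"
    and nonneg: "\<And>z. 0 \<le> f z"
  shows "arclength_integral (polygon p N) f \<le> (\<Sum>i<N. dist (p i) (p (Suc i)) * M i)"
proof -
  define F where "F s = f (arclength_parametrization (polygon p N) s)" for s
  define S where "S i = (\<Sum>j<i. dist (p j) (p (Suc j)))" for i
  have "arclength (polygon p N) = S N"
    by (simp add: arclength_def arclength_between_polygon polygon_length_1 S_def)
  then have eq: "arclength_integral (polygon p N) f = integral {0..S N} F"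
    unfolding arclength_integral_def F_def by simp
  have M: "0 \<le> M i" if "i < N" for i
    using f[OF that, of "p i"] nonneg[of "p i"] by simp
  \<comment> \<open>No measurability of \<open>f\<close> is assumed: the integral of a non-integrable function is 0.\<close>
  show ?thesis
  proof (cases "F integrable_on {0..S N}")
    case True
    have S_mono: "S i \<le> S k" if "i \<le> k" for i k
      unfolding S_def using that by (intro sum_mono2) auto
    have S_nonneg: "0 \<le> S i" for i
      unfolding S_def by (intro sum_nonneg) auto
    \<comment> \<open>Induction over the edges passed: the range of lengths is cut at the partial
      sums \<open>S k\<close>.\<close>
    have "integral {0..S k} F \<le> (\<Sum>i<k. dist (p i) (p (Suc i)) * M i)" if "k \<le> N" for k
      using that
    proof (induction k)
      case 0
      show ?case by (simp add: S_def)
    next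
      case (Suc k)
      have int: "F integrable_on {0..S (Suc k)}" "F integrable_on {S k..S (Suc k)}"
        using S_nonneg[of k] S_mono[OF Suc.prems]
        by (simp_all add: integrable_subinterval_real[OF True])
      have "integral {0..S (Suc k)} F = integral {0..S k} F + integral {S k..S (Suc k)} F"
        using Henstock_Kurzweil_Integration.integral_combine[OF S_nonneg S_mono[of k "Suc k"] int(1)] by simp
      \<comment> \<open>The endpoints are dropped because
        \<open>arclength_parametrization_polygon\<close> locates only lengths strictly inside an
        edge.\<close>
      also have "integral {S k..S (Suc k)} F = integral {S k<..<S (Suc k)} F"
        by (rule integral_open_interval_real)
      also have "\<dots> \<le> integral {S k<..<S (Suc k)} (\<lambda>_. M k)"
      proof (rule integral_le)
        show "F integrable_on {S k<..<S (Suc k)}"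
          using int(2) by (simp add: integrable_on_open_interval_real)
        show "(\<lambda>_. M k) integrable_on {S k<..<S (Suc k)}"
          by (simp add: integrable_on_open_interval_real integrable_const_ivl)
        show "F s \<le> M k" if "s \<in> {S k<..<S (Suc k)}" for s
          unfolding F_def using that Suc.prems
          by (intro f arclength_parametrization_polygon) (auto simp: S_def)
      qed
      also have "\<dots> = dist (p k) (p (Suc k)) * M k"
        by (simp add: S_def integral_open_interval_real[symmetric])
      finally show ?case using Suc by simp
    qed
    from this[of N] show ?thesis by (simp add: eq)
  next
    case False
    then show ?thesis
      unfolding eq not_integrable_integral[OF False]
      by (intro sum_nonneg mult_nonneg_nonneg M) auto
  qed
qed

section \<open>Counting chain points by volume\<close>

text \<open>The balls of radius \<open>e\<close> about the points are disjoint and lie in the ball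
  of radius \<open>r + e\<close> about \<open>c\<close>; compare volumes and cancel that of the unit
  ball.\<close>

lemma card_separated_le:
  fixes p :: "'i \<Rightarrow> 'a::euclidean_space"
  assumes "finite I" "0 < e" "0 \<le> r"
    and in_ball: "\<And>i. i \<in> I \<Longrightarrow> dist c (p i) \<le> r"
    and sep: "\<And>i j. i \<in> I \<Longrightarrow> j \<in> I \<Longrightarrow> i \<noteq> j \<Longrightarrow> 2 * e \<le> dist (p i) (p j)"
  shows "real (card I) * e ^ DIM('a) \<le> (r + e) ^ DIM('a)"
proof -
  define v where "v = unit_ball_vol (real DIM('a))"
  have "v > 0" by (simp add: v_def)
  have "disjnt (ball (p i) e) (ball (p j) e)" if "i \<in> I" "j \<in> I" "i \<noteq> j" for i j
  proof -
    have "dist (p i) (p j) < 2 * e" if "dist (p i) z < e" "dist (p j) z < e" for z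
      using that dist_triangle2[of "p i" "p j" z] by linarith
    with sep[OF that] show ?thesis by (force simp: disjnt_iff)
  qed
  then have disj: "pairwise (\<lambda>i j. disjnt (ball (p i) e) (ball (p j) e)) I"
    by (simp add: pairwise_def)
  have "(\<Union>i\<in>I. ball (p i) e) \<subseteq> ball c (r + e)"
  proof clarify
    fix i z assume "i \<in> I" "z \<in> ball (p i) e"
    then show "z \<in> ball c (r + e)"
      using in_ball[of i] dist_triangle[of c z "p i"] by simp
  qed
  moreover have fm: "ball z s \<in> fmeasurable lborel" for z :: 'a and s
    by (intro fmeasurableI emeasure_lborel_ball_finite) auto
  ultimately have "measure lborel (\<Union>i\<in>I. ball (p i) e) \<le> measure lborel (ball c (r + e))"
    by (intro measure_mono_fmeasurable) (auto intro: borel_open)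
  also have "measure lborel (\<Union>i\<in>I. ball (p i) e) = (\<Sum>i\<in>I. measure lborel (ball (p i) e))"
    by (intro measure_UNION' disj assms(1) fm)
  also have "\<dots> = real (card I) * (v * e ^ DIM('a))"
    using assms by (simp add: content_ball v_def)
  also have "measure lborel (ball c (r + e)) = v * (r + e) ^ DIM('a)"
    using assms by (simp add: content_ball v_def)
  finally have "v * (real (card I) * e ^ DIM('a)) \<le> v * (r + e) ^ DIM('a)"
    by (simp add: mult_ac)
  with \<open>v > 0\<close> show ?thesis by simp
qed

text \<open>Consecutive points may be arbitrarily close, so the indices are split by parity, which
  gives the factor 2. Within a parity class the points are at least \<open>\<delta> / 2\<close>
  apart, and packing with \<open>e = \<delta> / 4\<close> and \<open>r = 2 * b * \<delta>\<close>
  gives the ratio \<open>(r + e) / e = 8 * b + 1\<close>.\<close>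

lemma card_shortest_chain_scale_le:
  fixes p :: "nat \<Rightarrow> 'a::euclidean_space"
  assumes sep: "\<And>i j. i + 2 \<le> j \<Longrightarrow> j \<le> N \<Longrightarrow> d (p i) / 2 < dist (p i) (p j)"
    and "0 < \<delta>" "0 \<le> b"
  shows "real (card {i \<in> {..N}. dist c (p i) \<le> 2 * b * \<delta> \<and> \<delta> \<le> d (p i)}) \<le> 2 * (8 * b + 1) ^ DIM('a)"
proof -
  define I where "I = {i \<in> {..N}. dist c (p i) \<le> 2 * b * \<delta> \<and> \<delta> \<le> d (p i)}"
  have parity: "real (card {i \<in> I. i mod 2 = k}) \<le> (8 * b + 1) ^ DIM('a)" (is "real (card ?J) \<le> _") for k
  proof -
    have lt: "\<delta> / 2 \<le> dist (p i) (p j)" if "i \<in> ?J" "j \<in> ?J" "i < j" for i j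
    proof -
      have "i + 2 \<le> j"
        using that by (cases "j = Suc i") (auto simp: mod_Suc split: if_splits)
      then show ?thesis using sep[of i j] that by (force simp: I_def)
    qed
    have "2 * (\<delta> / 4) \<le> dist (p i) (p j)" if "i \<in> ?J" "j \<in> ?J" "i \<noteq> j" for i j
      using lt[of i j] lt[of j i] that by (cases i j rule: linorder_cases) (auto simp: dist_commute)
    then have "real (card ?J) * (\<delta> / 4) ^ DIM('a) \<le> (2 * b * \<delta> + \<delta> / 4) ^ DIM('a)"
      using assms by (intro card_separated_le[where p = p and c = c]) (auto simp: I_def)
    also have "2 * b * \<delta> + \<delta> / 4 = (8 * b + 1) * (\<delta> / 4)" by (simp add: algebra_simps)
    finally have "real (card ?J) * (\<delta> / 4) ^ DIM('a) \<le> (8 * b + 1) ^ DIM('a) * (\<delta> / 4) ^ DIM('a)"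
      by (simp only: power_mult_distrib)
    then show ?thesis by (rule mult_right_le_imp_le) (simp add: assms(2))
  qed
  have "card ({i \<in> I. i mod 2 = 0} \<union> {i \<in> I. i mod 2 = 1}) \<le>
      card {i \<in> I. i mod 2 = 0} + card {i \<in> I. i mod 2 = 1}"
    by (rule card_Un_le)
  also have "{i \<in> I. i mod 2 = 0} \<union> {i \<in> I. i mod 2 = 1} = I" by auto
  finally have "real (card I) \<le> real (card {i \<in> I. i mod 2 = 0}) + real (card {i \<in> I. i mod 2 = 1})"
    by linarith
  with parity[of 0] parity[of 1] show ?thesis by (simp add: I_def)
qed

text \<open>The points are sorted into the scales \<open>2^m * d c / 4 \<le> dist c (p i) < 2^m * d c / 2\<close>; scale 0
  also takes in the points nearer to \<open>c\<close>, where \<open>d\<close> is bounded below by its Lipschitz property.\<close>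

lemma card_shortest_chain_near_le:
  fixes p :: "nat \<Rightarrow> 'a::euclidean_space"
  assumes sep: "\<And>i j. i + 2 \<le> j \<Longrightarrow> j \<le> N \<Longrightarrow> d (p i) / 2 < dist (p i) (p j)"
    and pos: "0 < d c" and lip: "\<And>i. i \<le> N \<Longrightarrow> d c \<le> d (p i) + dist c (p i)"
    and far: "\<And>i. i \<le> N \<Longrightarrow> dist c (p i) \<le> a * D"
    and "1 \<le> a" "1 \<le> b" "0 \<le> D"
  shows "real (card {i \<in> {..N}. dist c (p i) \<le> b * d (p i)}) \<le>
    (3 + log 2 a + log 2 (1 + D / d c)) * (2 * (8 * b + 1) ^ DIM('a))"
proof -
  \<comment> \<open>A point on a scale \<open>m > 0\<close> satisfies
    \<open>2 ^ m * d c / 4 \<le> a * D\<close>, hence \<open>2 ^ m \<le> X\<close>. The summand 1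
    ensures \<open>X \<ge> 1\<close>, so its logarithm is nonnegative; \<open>M\<close> is then the
    last scale that can occur.\<close>
  define X where "X = 4 * a * (1 + D / d c)"
  define M where "M = nat \<lfloor>log 2 X\<rfloor>"
  \<comment> \<open>Lower bound for \<open>d\<close> on scale \<open>m\<close>: the inner radius
    \<open>2 ^ m * d c / 4\<close> divided by \<open>b\<close>. Then
    \<open>2 * b * \<delta> m\<close> is the outer radius.\<close>
  define \<delta> where "\<delta> m = 2 ^ m * d c / (4 * b)" for m :: nat
  have ge1: "1 \<le> 1 + D / d c" using assms by simp
  have "1 * 1 \<le> a * (1 + D / d c)"
    using assms ge1 by (intro mult_mono) auto
  then have X1: "1 \<le> X" by (simp add: X_def)
  define J where "J m = {i \<in> {..N}. dist c (p i) \<le> 2 * b * \<delta> m \<and> \<delta> m \<le> d (p i)}" for m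
  have "i \<in> (\<Union>m\<le>M. J m)" if "i \<le> N" and i: "dist c (p i) \<le> b * d (p i)" for i
  proof -
    define P where "P m \<longleftrightarrow> dist c (p i) < 2 ^ m * (d c / 2)" for m :: nat
    obtain m0 where "dist c (p i) / (d c / 2) < 2 ^ m0"
      using real_arch_pow[of 2 "dist c (p i) / (d c / 2)"] by auto
    then have "P m0" using pos by (simp add: P_def field_simps)
    \<comment> \<open>For the least \<open>m\<close>, failure of \<open>P\<close> at the predecessor
      is the inner bound of the dyadic shell.\<close>
    define m where "m = (LEAST m. P m)"
    have Pm: "P m" unfolding m_def using \<open>P m0\<close> by (rule LeastI)
    have "\<delta> m \<le> d (p i) \<and> m \<le> M"
    proof (cases m)
      case 0
      then have "d c / 2 \<le> d (p i)" using Pm lip[OF that(1)] by (simp add: P_def)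
      moreover have "\<delta> m \<le> d c / 2"
        using 0 pos assms(6) by (simp add: \<delta>_def field_simps)
      ultimately show ?thesis using 0 by simp
    next
      case (Suc k)
      then have "\<not> P k" using not_less_Least[of k P] by (simp add: m_def)
      then have k: "2 ^ m * (d c / 4) \<le> dist c (p i)" by (simp add: P_def Suc not_less mult_ac)
      have \<delta>m: "\<delta> m \<le> d (p i)"
        using order_trans[OF k i] assms(6) by (simp add: \<delta>_def field_simps)
      have "2 ^ m * (d c / 4) \<le> a * D"
        using k far[OF that(1)] by linarith
      then have "2 ^ m \<le> 4 * a * (D / d c)"
        using pos by (simp add: field_simps)
      also have "\<dots> \<le> X" unfolding X_def using assms by (intro mult_left_mono) auto
      finally have "real m \<le> log 2 X"
        using X1 by (simp add: le_log_iff powr_realpow)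
      then have "m \<le> M" unfolding M_def by linarith
      with \<delta>m show ?thesis by blast
    qed
    moreover have "dist c (p i) \<le> 2 * b * \<delta> m"
      using Pm assms(6) by (simp add: P_def \<delta>_def mult_ac)
    ultimately show ?thesis using that(1) by (auto simp: J_def)
  qed
  then have "card {i \<in> {..N}. dist c (p i) \<le> b * d (p i)} \<le> card (\<Union>m\<le>M. J m)"
    by (intro card_mono) (auto simp: J_def)
  also have "\<dots> \<le> (\<Sum>m\<le>M. card (J m))"
    by (rule card_UN_le) simp
  finally have "real (card {i \<in> {..N}. dist c (p i) \<le> b * d (p i)}) \<le> (\<Sum>m\<le>M. real (card (J m)))"
    by (simp flip: of_nat_sum)
  also have "\<dots> \<le> (\<Sum>m\<le>M. 2 * (8 * b + 1) ^ DIM('a))"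
    unfolding J_def using pos assms(6)
    by (intro sum_mono card_shortest_chain_scale_le sep) (auto simp: \<delta>_def)
  also have "\<dots> = (real M + 1) * (2 * (8 * b + 1) ^ DIM('a))" by simp
  \<comment> \<open>The scales 0 to \<open>M\<close> number \<open>M + 1\<close>; with
    \<open>log 2 4 = 2\<close> this makes the constant 3.\<close>
  also have "\<dots> \<le> (3 + log 2 a + log 2 (1 + D / d c)) * (2 * (8 * b + 1) ^ DIM('a))"
  proof (rule mult_right_mono)
    have "0 \<le> log 2 X" using X1 by simp
    then have M: "real M \<le> log 2 X" unfolding M_def by linarith
    have "1 + D / d c \<noteq> 0" using ge1 by linarith
    have "log 2 X = log 2 4 + log 2 a + log 2 (1 + D / d c)"
      unfolding X_def using \<open>1 \<le> a\<close> \<open>1 + D / d c \<noteq> 0\<close> by (simp add: log_mult)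
    also have "log 2 4 = (2::real)"
      using log_pow_cancel[of 2 2] by simp
    finally show "real M + 1 \<le> 3 + log 2 a + log 2 (1 + D / d c)" using M by simp
  qed (use assms in auto)
  finally show ?thesis .
qed

section \<open>Shortest chains along a curve\<close>

lemma shortest_chain:
  fixes d :: "'a::metric_space \<Rightarrow> real"
  assumes "path g" "continuous_on (path_image g) d" "\<And>z. z \<in> path_image g \<Longrightarrow> 0 < d z"
  obtains p N where "p 0 = pathstart g" "p N = pathfinish g"
    "\<And>i. i \<le> N \<Longrightarrow> p i \<in> path_image g"
    "\<And>i. i < N \<Longrightarrow> dist (p i) (p (Suc i)) \<le> d (p i) / 2"
    "\<And>i j. i + 2 \<le> j \<Longrightarrow> j \<le> N \<Longrightarrow> d (p i) / 2 < dist (p i) (p j)"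
proof -
  \<comment> \<open>Membership in \<open>R ^^ n\<close> means a chain of \<open>n\<close> admissible
    steps, so a shortest chain corresponds to the least exponent.\<close>
  define R where "R = {(u, v). u \<in> path_image g \<and> v \<in> path_image g \<and> dist u v \<le> d u / 2}"
  have "\<exists>n. (pathstart g, pathfinish g) \<in> R ^^ n"
  proof -
    \<comment> \<open>\<open>d\<close> has a positive minimum on the compact image; by uniform
      continuity a fine equal subdivision has steps below half of it.\<close>
    obtain z where z: "z \<in> path_image g" "\<And>w. w \<in> path_image g \<Longrightarrow> d z \<le> d w"
      using continuous_attains_inf[OF compact_path_image[OF assms(1)] path_image_nonempty assms(2)]
      by blast
    have "uniformly_continuous_on {0..1} g"
      using assms(1) by (simp add: path_def compact_uniformly_continuous)
    moreover have "0 < d z / 2" using assms(3) z(1) by simp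
    ultimately obtain e where "0 < e"
      and e: "\<And>s t. s \<in> {0..1} \<Longrightarrow> t \<in> {0..1} \<Longrightarrow> dist t s < e \<Longrightarrow> dist (g t) (g s) < d z / 2"
      unfolding uniformly_continuous_on_def by metis
    obtain n where n: "inverse (real (Suc n)) < e"
      using reals_Archimedean[OF \<open>0 < e\<close>] by blast
    define f where "f i = g (real i / real (Suc n))" for i
    have "(f i, f (Suc i)) \<in> R" if "i < Suc n" for i
    proof -
      have I: "real i / real (Suc n) \<in> {0..1}" "real (Suc i) / real (Suc n) \<in> {0..1}"
        using that by (auto simp: field_simps)
      have "dist (real i / real (Suc n)) (real (Suc i) / real (Suc n)) = inverse (real (Suc n))"
        by (simp add: dist_real_def divide_simps)
      with n e[OF I(2) I(1)] have "dist (f i) (f (Suc i)) < d z / 2" by (simp add: f_def)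
      moreover have "f i \<in> path_image g" "f (Suc i) \<in> path_image g"
        using I by (auto simp: f_def path_image_def)
      ultimately show ?thesis using z(2)[of "f i"] by (simp add: R_def)
    qed
    moreover have "f 0 = pathstart g" "f (Suc n) = pathfinish g"
      by (auto simp: f_def pathstart_def pathfinish_def)
    ultimately show ?thesis
      unfolding relpow_fun_conv by blast
  qed
  then obtain N where N: "(pathstart g, pathfinish g) \<in> R ^^ N"
    and least: "\<And>m. (pathstart g, pathfinish g) \<in> R ^^ m \<Longrightarrow> N \<le> m"
    using exists_least_iff[of "\<lambda>n. (pathstart g, pathfinish g) \<in> R ^^ n"] not_le by blast
  obtain p where p: "p 0 = pathstart g" "p N = pathfinish g" "\<And>i. i < N \<Longrightarrow> (p i, p (Suc i)) \<in> R"
    using N unfolding relpow_fun_conv by blast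
  have image: "p i \<in> path_image g" if "i \<le> N" for i
  proof (cases "i = N")
    case False
    with that p(3)[of i] show ?thesis by (simp add: R_def)
  qed (simp add: p(2) pathfinish_in_path_image)
  have segment: "(p i, p (i + k)) \<in> R ^^ k" if "i + k \<le> N" for i k
    unfolding relpow_fun_conv using that p(3) by (intro exI[of _ "\<lambda>l. p (i + l)"]) auto
  have "d (p i) / 2 < dist (p i) (p j)" if "i + 2 \<le> j" "j \<le> N" for i j
  proof (rule ccontr)
    assume "\<not> d (p i) / 2 < dist (p i) (p j)"
    then have "(p i, p j) \<in> R" using that image by (simp add: R_def)
    moreover have "(p 0, p i) \<in> R ^^ i" "(p j, p N) \<in> R ^^ (N - j)"
      using segment[of 0 i] segment[of j "N - j"] that by auto
    \<comment> \<open>One step from \<open>p i\<close> to \<open>p j\<close> would replace at least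
      two, leaving fewer than \<open>N\<close> in total.\<close>
    ultimately have "(p 0, p N) \<in> R ^^ (i + (1 + (N - j)))"
      unfolding relpow_add by (auto simp: relcomp_unfold)
    then show False using least[of "i + (1 + (N - j))"] p that by simp
  qed
  then show ?thesis
    using that[of p N] p image by (auto simp: R_def)
qed

text \<open>A single chord is itself a polygonal sum. This confines the chain to radius
  \<open>a * dist x y\<close> about either endpoint, which bounds the number of scales.\<close>

lemma dist_le_arclength:
  assumes "rectifiable_path g" "z \<in> path_image g"
  shows "dist (pathstart g) z \<le> arclength g" "dist (pathfinish g) z \<le> arclength g"
proof -
  from assms(2) obtain t where t: "t \<in> {0..1}" "z = g t" by (auto simp: path_image_def)
  have *: "dist (g u) (g v) \<le> arclength g" if "0 \<le> u" "u \<le> v" "v \<le> 1" for u v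
  proof -
    define \<tau> where "\<tau> i = (if i = 0 then u else v)" for i :: nat
    have "dist (g u) (g v) = (\<Sum>i<1. dist (g (\<tau> i)) (g (\<tau> (Suc i))))"
      by (simp add: \<tau>_def)
    moreover have "mono_on {..1} \<tau>" "\<tau> ` {..1} \<subseteq> {0..1}"
      using that by (auto simp: \<tau>_def mono_on_def)
    ultimately have "dist (g u) (g v) \<in> polygonal_sums g 0 1"
      unfolding polygonal_sums_def by blast
    then show ?thesis
      using assms(1) unfolding arclength_def arclength_between_def rectifiable_path_def
      by (intro cSup_upper) auto
  qed
  show "dist (pathstart g) z \<le> arclength g" "dist (pathfinish g) z \<le> arclength g"
    using *[of 0 t] *[of t 1] t by (auto simp: pathstart_def pathfinish_def dist_commute)
qed

section \<open>Boundary distance and quasihyperbolic length of chains\<close>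

lemma boundary_dist_pos:
  assumes "open \<Omega>" "\<Omega> \<noteq> {}" "\<Omega> \<noteq> UNIV" "z \<in> \<Omega>"
  shows "0 < boundary_dist \<Omega> (z :: 'a::real_normed_vector)"
  unfolding boundary_dist_def
proof (rule infdist_pos_not_in_closed)
  \<comment> \<open>The distance to an empty set is 0 by default, so the frontier must be seen to be
    nonempty; this is where properness of \<open>\<Omega>\<close> enters.\<close>
  show "frontier \<Omega> \<noteq> {}" using assms by (simp add: frontier_eq_empty)
  show "z \<notin> frontier \<Omega>" using assms by (simp add: frontier_def interior_open)
qed simp

lemma boundary_dist_triangle: "boundary_dist \<Omega> u \<le> boundary_dist \<Omega> v + dist u v"
  unfolding boundary_dist_def by (rule infdist_triangle)

text \<open>A segment leaving \<open>\<Omega>\<close> would meet the frontier at a point no farther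
  from \<open>u\<close> than \<open>v\<close> is.\<close>

lemma closed_segment_subset_domain:
  fixes u v :: "'a::real_normed_vector"
  assumes "u \<in> \<Omega>" "dist u v < boundary_dist \<Omega> u"
  shows "closed_segment u v \<subseteq> \<Omega>"
proof (rule ccontr)
  assume "\<not> closed_segment u v \<subseteq> \<Omega>"
  then have "closed_segment u v \<inter> frontier \<Omega> \<noteq> {}"
    using assms(1) by (intro connected_Int_frontier) auto
  then obtain w where w: "w \<in> closed_segment u v" "w \<in> frontier \<Omega>" by blast
  have "boundary_dist \<Omega> u \<le> dist u w"
    unfolding boundary_dist_def by (rule infdist_le[OF w(2)])
  also have "\<dots> \<le> dist u v"
    using segment_bound(1)[OF w(1)] by (simp add: dist_norm norm_minus_commute)
  finally show False using assms(2) by simp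
qed

text \<open>Along an edge from \<open>p i\<close> the boundary distance drops by at most half, so
  the integrand is at most \<open>2 / boundary_dist \<Omega> (p i)\<close>, the reciprocal of the
  largest edge length allowed: each edge costs at most 1.\<close>

lemma quasihyperbolic_dist_le_chain_length:
  fixes p :: "nat \<Rightarrow> 'a::real_normed_vector"
  assumes \<Omega>: "open \<Omega>" "\<Omega> \<noteq> {}" "\<Omega> \<noteq> UNIV"
    and p: "\<And>i. i \<le> N \<Longrightarrow> p i \<in> \<Omega>"
    and step: "\<And>i. i < N \<Longrightarrow> dist (p i) (p (Suc i)) \<le> boundary_dist \<Omega> (p i) / 2"
  shows "quasihyperbolic_dist \<Omega> (p 0) (p N) \<le> real N"
proof -
  let ?d = "boundary_dist \<Omega>" and ?f = "\<lambda>z. 1 / boundary_dist \<Omega> z"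
  have pos: "0 < ?d (p i)" if "i \<le> N" for i
    using \<Omega> p[OF that] by (rule boundary_dist_pos)
  have nonneg: "0 \<le> ?f z" for z
    by (simp add: boundary_dist_def infdist_nonneg)
  have segment: "closed_segment (p i) (p (Suc i)) \<subseteq> \<Omega>" if "i < N" for i
    using that p[of i] pos[of i] step[OF that] by (intro closed_segment_subset_domain) auto
  have "polygon p N t \<in> \<Omega>" if t: "t \<in> {0..1}" for t
  proof (cases "N = 0")
    case True
    with p[of 0] show ?thesis by (simp add: polygon_def)
  next
    case False
    then obtain i where i: "i < N" "real i \<le> real N * t" "real N * t \<le> real i + 1"
      using edge_exists[OF t] by blast
    have "polygon p N t \<in> closed_segment (p i) (p (Suc i))"
      using polygon_on_edge_in_segment[OF i] .
    with segment[OF i(1)] show ?thesis by blast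
  qed
  then have "joins_in (polygon p N) \<Omega> (p 0) (p N)"
    by (auto simp: joins_in_def rectifiable_path_polygon pathstart_def pathfinish_def
        polygon_0 polygon_1 path_image_def)
  then have "quasihyperbolic_dist \<Omega> (p 0) (p N) \<le> arclength_integral (polygon p N) ?f"
    unfolding quasihyperbolic_dist_def
    by (intro cInf_lower bdd_belowI[of _ 0]) (auto intro!: arclength_integral_nonneg nonneg)
  also have "\<dots> \<le> (\<Sum>i<N. dist (p i) (p (Suc i)) * (2 / ?d (p i)))"
  proof (rule arclength_integral_polygon_le)
    fix i z assume i: "i < N" and z: "z \<in> closed_segment (p i) (p (Suc i))"
    have "dist (p i) z \<le> dist (p i) (p (Suc i))"
      using segment_bound(1)[OF z] by (simp add: dist_norm norm_minus_commute)
    then have "?d (p i) / 2 \<le> ?d z"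
      using boundary_dist_triangle[of \<Omega> "p i" z] step[OF i] by linarith
    then show "?f z \<le> 2 / ?d (p i)"
      using pos[of i] i by (simp add: field_simps)
  qed (rule nonneg)
  also have "\<dots> \<le> (\<Sum>i<N. 1)"
  proof (rule sum_mono)
    fix i assume "i \<in> {..<N}"
    then show "dist (p i) (p (Suc i)) * (2 / ?d (p i)) \<le> 1"
      using step[of i] pos[of i] by (simp add: field_simps)
  qed
  finally show ?thesis by simp
qed

section \<open>Assembling the estimate\<close>

lemma quasihyperbolic_dist_le_distance_ratio:
  fixes \<Omega> :: "'a::euclidean_space set"
  assumes \<Omega>: "open \<Omega>" "\<Omega> \<noteq> {}" "\<Omega> \<noteq> UNIV"
    and ab: "1 \<le> a" "1 \<le> b"
    and \<gamma>: "joins_in \<gamma> \<Omega> x y" "arclength \<gamma> \<le> a * dist x y"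
    and cone: "\<And>z. z \<in> path_image \<gamma> \<Longrightarrow> min (dist x z) (dist y z) \<le> b * boundary_dist \<Omega> z"
  shows "quasihyperbolic_dist \<Omega> x y \<le> 12 * 9 ^ DIM('a) * a ^ DIM('a) * b ^ DIM('a) * (1 + distance_ratio \<Omega> x y)"
proof -
  let ?n = "DIM('a)" and ?d = "boundary_dist \<Omega>"
  have path: "rectifiable_path \<gamma>" "path_image \<gamma> \<subseteq> \<Omega>" "pathstart \<gamma> = x" "pathfinish \<gamma> = y"
    using \<gamma>(1) by (auto simp: joins_in_def)
  have "path \<gamma>" using path(1) by (simp add: rectifiable_path_def)
  have pos: "0 < ?d z" if "z \<in> path_image \<gamma>" for z
    using boundary_dist_pos[OF \<Omega>] that path(2) by blast
  have cont: "continuous_on (path_image \<gamma>) ?d"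
    unfolding boundary_dist_def by (intro continuous_intros)
  obtain p N where p: "p 0 = x" "p N = y" "\<And>i. i \<le> N \<Longrightarrow> p i \<in> path_image \<gamma>"
      "\<And>i. i < N \<Longrightarrow> dist (p i) (p (Suc i)) \<le> ?d (p i) / 2"
    and sep: "\<And>i j. i + 2 \<le> j \<Longrightarrow> j \<le> N \<Longrightarrow> ?d (p i) / 2 < dist (p i) (p j)"
    by (rule shortest_chain[OF \<open>path \<gamma>\<close> cont pos, unfolded path(3,4)])
      (assumption, rule that, assumption+)
  define Q where "Q = 2 * (8 * b + 1) ^ ?n"
  define D where "D = dist x y"
  have near: "real (card {i \<in> {..N}. dist c (p i) \<le> b * ?d (p i)}) \<le> (3 + log 2 a + log 2 (1 + D / ?d c)) * Q"
    if "c \<in> {x, y}" for c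
    unfolding Q_def
  proof (rule card_shortest_chain_near_le[where a = a])
    have "c \<in> path_image \<gamma>" using that p by force
    then show "0 < ?d c" by (rule pos)
    show "dist c (p i) \<le> a * D" if "i \<le> N" for i
      using dist_le_arclength[OF path(1) p(3)[OF that]] \<gamma>(2) path \<open>c \<in> {x, y}\<close> by (auto simp: D_def)
  qed (use ab sep boundary_dist_triangle in \<open>auto simp: D_def\<close>)
  \<comment> \<open>By the minimum in the hypothesis on the curve, every vertex is counted about
    \<open>x\<close> or about \<open>y\<close>.\<close>
  have "{..N} \<subseteq> {i \<in> {..N}. dist x (p i) \<le> b * ?d (p i)} \<union> {i \<in> {..N}. dist y (p i) \<le> b * ?d (p i)}"
    using cone[OF p(3)] by (auto simp: min_le_iff_disj)
  then have "card {..N} \<le> card ({i \<in> {..N}. dist x (p i) \<le> b * ?d (p i)} \<union> {i \<in> {..N}. dist y (p i) \<le> b * ?d (p i)})"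
    by (intro card_mono) auto
  also have "\<dots> \<le> card {i \<in> {..N}. dist x (p i) \<le> b * ?d (p i)} + card {i \<in> {..N}. dist y (p i) \<le> b * ?d (p i)}"
    by (rule card_Un_le)
  finally have "real N \<le> real (card {i \<in> {..N}. dist x (p i) \<le> b * ?d (p i)})
      + real (card {i \<in> {..N}. dist y (p i) \<le> b * ?d (p i)})"
    by simp
  also have "\<dots> \<le> (3 + log 2 a + log 2 (1 + D / ?d x)) * Q + (3 + log 2 a + log 2 (1 + D / ?d y)) * Q"
    by (intro add_mono near) auto
  also have "\<dots> = (6 + 2 * log 2 a + (log 2 (1 + D / ?d x) + log 2 (1 + D / ?d y))) * Q"
    by (simp add: algebra_simps)
  \<comment> \<open>With \<open>j\<close> the distance ratio, the two logarithms of
    \<open>1 + D / d\<close> contribute at most \<open>3 * j\<close> and \<open>2 * log 2 a\<close>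
    at most \<open>3 * a - 3\<close>; the sum \<open>3 + 3 * a + 3 * j\<close> is absorbed using
    \<open>a \<ge> 1\<close>.\<close>
  also have "\<dots> \<le> (6 * a * (1 + distance_ratio \<Omega> x y)) * Q"
  proof (rule mult_right_mono)
    define j where "j = distance_ratio \<Omega> x y"
    have "x \<in> path_image \<gamma>" "y \<in> path_image \<gamma>" using path by auto
    then have ge1: "1 \<le> 1 + D / ?d x" "1 \<le> 1 + D / ?d y"
      using pos by (simp_all add: D_def less_imp_le)
    then have j: "2 * j = ln (1 + D / ?d x) + ln (1 + D / ?d y)"
      by (simp add: j_def distance_ratio_def D_def ln_mult)
    with ge1 have "0 \<le> j" using ln_ge_zero[OF ge1(1)] ln_ge_zero[OF ge1(2)] by linarith
    \<comment> \<open>The factor \<open>3 / 2\<close> comes from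
      \<open>ln 2 \<ge> 2 / 3\<close>.\<close>
    have log2: "log 2 u \<le> 3 / 2 * ln u" if "1 \<le> u" for u :: real
    proof -
      have "ln u * (2 / 3) \<le> ln u * ln 2"
        using ln2_ge_two_thirds that by (intro mult_left_mono) auto
      then show ?thesis by (simp add: log_def field_simps)
    qed
    have "2 * log 2 a \<le> 3 * a - 3"
      using log2[OF ab(1)] ln_le_minus_one[of a] ab(1) by simp
    moreover have "log 2 (1 + D / ?d x) + log 2 (1 + D / ?d y) \<le> 3 * j"
      using log2[OF ge1(1)] log2[OF ge1(2)] j by linarith
    moreover have "j \<le> a * j"
      using \<open>0 \<le> j\<close> ab(1) by (simp add: mult_le_cancel_right1)
    ultimately have "6 + 2 * log 2 a + (log 2 (1 + D / ?d x) + log 2 (1 + D / ?d y)) \<le> 6 * a + 6 * (a * j)"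
      using ab(1) \<open>0 \<le> j\<close> by linarith
    then show "6 + 2 * log 2 a + (log 2 (1 + D / ?d x) + log 2 (1 + D / ?d y)) \<le> 6 * a * (1 + distance_ratio \<Omega> x y)"
      by (simp add: j_def algebra_simps)
  qed (use ab in \<open>simp add: Q_def\<close>)
  also have "\<dots> = a * (8 * b + 1) ^ ?n * (12 * (1 + distance_ratio \<Omega> x y))"
    by (simp add: Q_def)
  \<comment> \<open>The bound so far is linear in \<open>a\<close>; it is weakened to the power
    \<open>n\<close>, and \<open>8 * b + 1 \<le> 9 * b\<close> since
    \<open>b \<ge> 1\<close>.\<close>
  also have "\<dots> \<le> a ^ ?n * (9 * b) ^ ?n * (12 * (1 + distance_ratio \<Omega> x y))"
  proof (intro mult_right_mono mult_mono)
    show "a \<le> a ^ ?n" using ab(1) by (intro self_le_power) auto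
    show "(8 * b + 1) ^ ?n \<le> (9 * b) ^ ?n" using ab by (intro power_mono) auto
    have "1 \<le> 1 + dist x y / ?d x" "1 \<le> 1 + dist x y / ?d y"
      by (simp_all add: boundary_dist_def infdist_nonneg)
    then have "1 * 1 \<le> (1 + dist x y / ?d x) * (1 + dist x y / ?d y)"
      by (intro mult_mono) auto
    then show "0 \<le> 12 * (1 + distance_ratio \<Omega> x y)"
      by (simp add: distance_ratio_def)
  qed (use ab in auto)
  finally have "real N \<le> 12 * 9 ^ ?n * a ^ ?n * b ^ ?n * (1 + distance_ratio \<Omega> x y)"
    by (simp add: power_mult_distrib algebra_simps)
  moreover have "quasihyperbolic_dist \<Omega> x y \<le> real N"
    using quasihyperbolic_dist_le_chain_length[OF \<Omega>, of N p] p path(2) by blast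
  ultimately show ?thesis by linarith
qed

theorem theorem2p4:
  shows "\<exists>C\<^sub>n::real. \<exists>C::real \<Rightarrow> real \<Rightarrow> real.
    (\<forall>a\<ge>1. \<forall>b\<ge>1. C a b \<le> C\<^sub>n * a ^ CARD('n) * b ^ CARD('n)) \<and>
    (\<forall>(\<Omega> :: (real ^ 'n) set) x y a b.
       open \<Omega> \<longrightarrow> connected \<Omega> \<longrightarrow> \<Omega> \<noteq> {} \<longrightarrow> \<Omega> \<noteq> UNIV \<longrightarrow> x \<in> \<Omega> \<longrightarrow> y \<in> \<Omega> \<longrightarrow> a \<ge> 1 \<longrightarrow> b \<ge> 1 \<longrightarrow>
       (\<exists>\<gamma>. joins_in \<gamma> \<Omega> x y \<and> arclength \<gamma> \<le> a * dist x y \<and>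
            (\<forall>z\<in>path_image \<gamma>. min (dist x z) (dist y z) \<le> b * boundary_dist \<Omega> z)) \<longrightarrow>
       quasihyperbolic_dist \<Omega> x y \<le> C a b * (1 + distance_ratio \<Omega> x y))"
proof -
  \<comment> \<open>\<open>C\<close> is chosen equal to its required upper bound, so the first
    conjunct holds with equality.\<close>
  let ?C = "\<lambda>a b :: real. 12 * 9 ^ CARD('n) * a ^ CARD('n) * b ^ CARD('n)"
  show ?thesis
  proof (rule exI[of _ "12 * 9 ^ CARD('n)"], rule exI[of _ ?C], intro conjI allI impI)
    fix \<Omega> :: "(real ^ 'n) set" and x y a b
    assume \<Omega>: "open \<Omega>" "connected \<Omega>" "\<Omega> \<noteq> {}" "\<Omega> \<noteq> UNIV" "x \<in> \<Omega>" "y \<in> \<Omega>"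
      and ab: "1 \<le> a" "1 \<le> b"
      and "\<exists>\<gamma>. joins_in \<gamma> \<Omega> x y \<and> arclength \<gamma> \<le> a * dist x y \<and>
        (\<forall>z\<in>path_image \<gamma>. min (dist x z) (dist y z) \<le> b * boundary_dist \<Omega> z)"
    then obtain \<gamma> where "joins_in \<gamma> \<Omega> x y" "arclength \<gamma> \<le> a * dist x y"
        "\<And>z. z \<in> path_image \<gamma> \<Longrightarrow> min (dist x z) (dist y z) \<le> b * boundary_dist \<Omega> z"
      by blast
    from quasihyperbolic_dist_le_distance_ratio[OF \<Omega>(1,3,4) ab this]
    show "quasihyperbolic_dist \<Omega> x y \<le> ?C a b * (1 + distance_ratio \<Omega> x y)"
      by simp
  qed simp
qed

end
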